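(* For each fixed integer $t\ge 3$, as $n\to\infty$, $$k_0(n,t,n)\le\frac{(t-1)\lg n}{\lg(\alpha(t))}(1+o(1)),\qquad \alpha(t)=\frac{(t-1)^{t}}{(t-1)^{t}-(t-1)(t-2)},$$ and for each fixed integer $t\ge 2$, as $n\to\infty$, $$k_0(n,t,t)\le\frac{(t-1)\lg n}{\lg(\beta(t))}(1+o(1)),\qquad \beta(t)=\frac{t^t}{t^t-t(t-1)}.$$
   Context: $\lg$ denotes $\log_2$. For a positive integer $t$, $[t]=\{1,\dots,t\}$. A word $w=w_1\cdots w_t$ of length $t$ over an alphabet induces the partition of $[t]$ in which $i$ and $j$ are in the same block iff $w_i=w_j$; two words are equivalent if they induce the same partition. For $n\ge t$, a $k\times n$ array with entries from the alphabet $\{1,\dots,d\}$ (or any $d$-letter alphabet) is a covering array for set partitions (with parameters $t,d$) if for each choice of $t$ columns, each of the $B(t)$ partitions of $[t]$ (into any number of parts, $B(t)$ being the Bell number) is induced by the word appearing in at least one of the rows of the selected $t$ columns (the columns being taken in their order from left to right). $k_0(n,t,d)$ denotes the minimum number $k$ of rows for which such a $k\times n$ array exists. In $k_0(n,t,n)$ the alphabet size equals the number $n$ of columns. The term $o(1)$ denotes a quantity tending to $0$ as $n\to\infty$ with $t$ fixed. *)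

theory Defs
  imports Complex_Main "HOL-Library.Disjoint_Sets" "HOL-Library.Landau_Symbols"
begin

text \<open>
  A word of length \<open>t\<close> is a function on positions, of which only the values on \<open>{1..t}\<close> matter.
\<close>

definition induced_partition :: "nat \<Rightarrow> (nat \<Rightarrow> nat) \<Rightarrow> nat set set" where
  "induced_partition t w = {1..t} // {(i, j). i \<in> {1..t} \<and> j \<in> {1..t} \<and> w i = w j}"

text \<open>
  \<open>A i j\<close> is the entry in row \<open>i\<close> and column \<open>j\<close> of a \<open>k \<times> n\<close> array; values outside
  \<open>{1..k} \<times> {1..n}\<close> are irrelevant. A choice of \<open>t\<close> columns, taken from left to right, is a
  strictly increasing map \<open>c\<close> from \<open>{1..t}\<close> to \<open>{1..n}\<close>. The notion is meant for \<open>1 \<le> t \<le> n\<close>.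
\<close>

definition is_partition_covering_array ::
    "nat \<Rightarrow> nat \<Rightarrow> nat \<Rightarrow> nat \<Rightarrow> (nat \<Rightarrow> nat \<Rightarrow> nat) \<Rightarrow> bool" where
  "is_partition_covering_array k n t d A \<longleftrightarrow>
     (\<forall>i\<in>{1..k}. \<forall>j\<in>{1..n}. A i j \<in> {1..d}) \<and>
     (\<forall>c P. strict_mono_on {1..t} c \<and> c ` {1..t} \<subseteq> {1..n} \<and> partition_on {1..t} P \<longrightarrow>
        (\<exists>i\<in>{1..k}. induced_partition t (\<lambda>j. A i (c j)) = P))"

text \<open>
  The minimum is taken over a nonempty set whenever \<open>1 \<le> t \<le> d\<close>; see \<open>k0_attained\<close> below.
\<close>

definition k0 :: "nat \<Rightarrow> nat \<Rightarrow> nat \<Rightarrow> nat" where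
  "k0 n t d = (LEAST k. \<exists>A. is_partition_covering_array k n t d A)"

definition alpha :: "nat \<Rightarrow> real" where
  "alpha t = (real t - 1) ^ t / ((real t - 1) ^ t - (real t - 1) * (real t - 2))"

definition beta :: "nat \<Rightarrow> real" where
  "beta t = real t ^ t / (real t ^ t - real t * (real t - 1))"

lemma partition_covering_array_exists:
  assumes "1 \<le> t" "t \<le> d"
  shows "\<exists>k A. is_partition_covering_array k n t d A"
proof -
  let ?F = "PiE {1..n} (\<lambda>_. {1..d})"
  have "finite ?F" by (intro finite_PiE) auto
  then obtain h where h: "bij_betw h {1..card ?F} ?F"
    using ex_bij_betw_nat_finite_1 by blast
  have "\<exists>i\<in>{1..card ?F}. induced_partition t (\<lambda>j. h i (c j)) = P"
    if c: "strict_mono_on {1..t} c" "c ` {1..t} \<subseteq> {1..n}" and P: "partition_on {1..t} P" for c P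
  proof -
    have inj: "inj_on c {1..t}" using c(1) by (rule strict_mono_on_imp_inj_on)
    have "\<exists>p\<in>P. j \<in> p" if "j \<in> {1..t}" for j
      using P that by (auto simp: partition_on_def)
    then obtain b where b: "b j \<in> P" "j \<in> b j" if "j \<in> {1..t}" for j by metis
    have buniq: "b j = p" if "p \<in> P" "j \<in> p" for j p
    proof -
      have "j \<in> {1..t}" using P that by (auto simp: partition_on_def)
      then have "b j \<in> P" "j \<in> b j" using b by auto
      then show ?thesis using disjointD[OF partition_onD2[OF P], of "b j" p] that by blast
    qed
    have sub: "P \<subseteq> b ` {1..t}"
    proof
      fix p assume p: "p \<in> P"
      then obtain j where j: "j \<in> p" using P by (force simp: partition_on_def)
      then have "j \<in> {1..t}" using P p by (auto simp: partition_on_def)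
      with buniq[OF p j] show "p \<in> b ` {1..t}" by blast
    qed
    then have fP: "finite P" by (rule finite_subset) simp
    have "card P \<le> t" using surj_card_le[OF _ sub] by simp
    then obtain g where g: "inj_on g P" "g ` P \<subseteq> {1..d}"
      using card_le_inj[OF fP, of "{1..d}"] assms by auto
    define f where "f x = (if x \<in> {1..n} then
        (if x \<in> c ` {1..t} then g (b (inv_into {1..t} c x)) else 1) else undefined)" for x
    have "f \<in> ?F"
      using assms g(2) b(1) inv_into_into[of _ c "{1..t}"]
      by (auto simp: f_def PiE_def extensional_def image_subset_iff simp del: atLeastAtMost_iff)
         (auto simp: inj)
    then have "f \<in> h ` {1..card ?F}" unfolding bij_betw_imp_surj_on[OF h] .
    then obtain i where i: "f = h i" "i \<in> {1..card ?F}" by (rule imageE)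
    have fc: "f (c j) = g (b j)" if "j \<in> {1..t}" for j
    proof -
      have "c j \<in> {1..n}" "c j \<in> c ` {1..t}" using that c(2) by blast+
      then show ?thesis unfolding f_def inv_into_f_f[OF inj that] by (simp only: if_True)
    qed
    have eq: "f (c j) = f (c l) \<longleftrightarrow> b j = b l" if "j \<in> {1..t}" "l \<in> {1..t}" for j l
      unfolding fc[OF that(1)] fc[OF that(2)] using inj_on_eq_iff[OF g(1)] b(1) that by blast
    let ?R = "{(j, l). j \<in> {1..t} \<and> l \<in> {1..t} \<and> f (c j) = f (c l)}"
    have "?R `` {j} = b j" if j: "j \<in> {1..t}" for j
    proof -
      have "b j \<subseteq> {1..t}" using b(1)[OF j] P by (auto simp: partition_on_def)
      have "b j = b l \<longleftrightarrow> l \<in> b j" if "l \<in> {1..t}" for l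
        using b[OF that] buniq[OF b(1)[OF j]] by metis
      then have "l \<in> {1..t} \<and> f (c j) = f (c l) \<longleftrightarrow> l \<in> b j" for l
        using eq[OF j, of l] \<open>b j \<subseteq> {1..t}\<close> by (meson subsetD)
      then show ?thesis using j by (intro set_eqI) (simp only: Image_singleton_iff mem_Collect_eq case_prod_conv simp_thms)
    qed
    then have "{1..t} // ?R = b ` {1..t}" 
      unfolding quotient_def UNION_singleton_eq_range by (rule image_cong[OF refl])
    also have "\<dots> = P" using sub b(1) by blast
    finally have "induced_partition t (\<lambda>j. h i (c j)) = P" unfolding induced_partition_def i(1)[symmetric] .
    with i(2) show ?thesis by blast
  qed
  moreover have "\<forall>i\<in>{1..card ?F}. \<forall>j\<in>{1..n}. h i j \<in> {1..d}"
    using bij_betwE[OF h] PiE_mem by fast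
  ultimately have "is_partition_covering_array (card ?F) n t d h"
    unfolding is_partition_covering_array_def by blast
  then show ?thesis by blast
qed

lemma k0_attained:
  assumes "1 \<le> t" "t \<le> d"
  shows "\<exists>A. is_partition_covering_array (k0 n t d) n t d A"
  unfolding k0_def using LeastI_ex[OF partition_covering_array_exists[OF assms]] by blast

end

theory Submission
  imports Defs "HOL-Library.FuncSet"
begin

text \<open>
  Both bounds come from one deletion argument, run with \<open>s = t - 1\<close> letters for the large
  alphabet and with \<open>s = t\<close> letters for the small one. A uniformly random word of length \<open>t\<close> over
  \<open>s\<close> letters induces a given partition with \<open>m\<close> blocks with probability
  \<open>s (s - 1) \<cdots> (s - m + 1) / s ^ t\<close>. For \<open>2 \<le> m \<le> s\<close> this is at least
  \<open>q = s (s - 1) / s ^ t\<close>, and \<open>1 / (1 - q)\<close> is \<open>alpha t\<close> or \<open>beta t\<close>. The partition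
  with one block can be less likely, but one constant row serves it on all columns at
  once; if \<open>s = t - 1\<close>, a row with distinct entries serves the partition into singletons in the
  same way. These two rows are absorbed by the \<open>o(1)\<close> term.

  Call a choice of \<open>t\<close> columns together with a partition that it misses a defect. Taking \<open>K\<close> rows
  on \<open>2 n\<close> columns, the expected number of defects among partitions with \<open>2 \<le> m \<le> s\<close> is at most
  \<open>(2 n) ^ t B (1 - q) ^ K\<close>, where \<open>B\<close> counts all partitions of \<open>{1..t}\<close>. Once this is at most \<open>n\<close>,
  deleting one column from each defect leaves \<open>n\<close> columns without defects. So it suffices that
  \<open>(1 / (1 - q)) ^ K\<close> is at least a constant multiple of \<open>n ^ (t - 1)\<close>; it is the deletion step
  that replaces the factor \<open>t\<close> of a plain union bound by \<open>t - 1\<close>.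

  The random choice is replaced by a greedy one: the rows are chosen one after another, each so
  that it resolves at least the average proportion \<open>q\<close> of the remaining defects
  (\<open>exists_rows_missing_few\<close>). The average is controlled by counting the words that induce a
  given partition (\<open>card_rows_inducing_ge\<close>), \<open>k0_le_if_defects_le\<close> carries out the deletion, and
  \<open>asymptotic_bound_of_power_bound\<close> solves for \<open>K\<close>.
\<close>

section \<open>Greedy choice of rows\<close>

text \<open>
  Averaging: a uniformly chosen \<open>f\<close> misses each \<open>x\<close> with probability at most \<open>1 - q\<close>, so some
  \<open>f\<close> misses at most that fraction of \<open>Y\<close>. The proof counts the missed pairs \<open>(f, x)\<close> in
  two ways.
\<close>

lemma exists_row_missing_few:
  fixes cov :: "'r \<Rightarrow> 'x \<Rightarrow> bool" and q :: real
  assumes "finite F" "F \<noteq> {}" "finite Y"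
    and dense: "\<And>x. x \<in> Y \<Longrightarrow> q * real (card F) \<le> real (card {f\<in>F. cov f x})"
  shows "\<exists>f\<in>F. real (card {x\<in>Y. \<not> cov f x}) \<le> (1 - q) * real (card Y)"
proof (rule ccontr)
  assume "\<not> ?thesis"
  then have less: "(1 - q) * real (card Y) < real (card {x\<in>Y. \<not> cov f x})" if "f \<in> F" for f
    using that by force
  have miss: "real (card {f\<in>F. \<not> cov f x}) \<le> (1 - q) * real (card F)" if "x \<in> Y" for x
  proof -
    have "card {f\<in>F. cov f x} + card {f\<in>F. \<not> cov f x} = card F"
      using card_Int_Diff[OF assms(1), of "{f. cov f x}"]
      by (simp add: Collect_conj_eq[symmetric] set_diff_eq Int_def)
    then have "real (card {f\<in>F. cov f x}) + real (card {f\<in>F. \<not> cov f x}) = real (card F)"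
      by linarith
    with dense[OF that] show ?thesis by (simp add: algebra_simps)
  qed
  have "(\<Sum>f\<in>F. (1 - q) * real (card Y)) < (\<Sum>f\<in>F. real (card {x\<in>Y. \<not> cov f x}))"
    using assms(1,2) less by (intro sum_strict_mono)
  also have "\<dots> = (\<Sum>f\<in>F. \<Sum>x\<in>Y. of_bool (\<not> cov f x))"
    using assms(3) by (simp add: Int_def)
  also have "\<dots> = (\<Sum>x\<in>Y. \<Sum>f\<in>F. of_bool (\<not> cov f x))" by (rule sum.swap)
  also have "\<dots> = (\<Sum>x\<in>Y. real (card {f\<in>F. \<not> cov f x}))"
    using assms(1) by (simp add: Int_def)
  also have "\<dots> \<le> (\<Sum>x\<in>Y. (1 - q) * real (card F))" using miss by (intro sum_mono)
  finally show False by (simp add: algebra_simps)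
qed

text \<open>
  Each new row is chosen by averaging over the targets that the earlier rows have all missed, so
  each row multiplies their number by at most \<open>1 - q\<close>.
\<close>

lemma exists_rows_missing_few:
  fixes cov :: "'r \<Rightarrow> 'x \<Rightarrow> bool" and q :: real
  assumes "finite F" "F \<noteq> {}" "finite X" "q \<le> 1"
    and dense: "\<And>x. x \<in> X \<Longrightarrow> q * real (card F) \<le> real (card {f\<in>F. cov f x})"
  shows "\<exists>h. (\<forall>i\<in>{1..K}. h i \<in> F) \<and>
    real (card {x\<in>X. \<forall>i\<in>{1..K}. \<not> cov (h i) x}) \<le> (1 - q) ^ K * real (card X)"
proof (induction K)
  case 0
  then show ?case by simp
next
  case (Suc K)
  then obtain h where h: "\<forall>i\<in>{1..K}. h i \<in> F"
    "real (card {x\<in>X. \<forall>i\<in>{1..K}. \<not> cov (h i) x}) \<le> (1 - q) ^ K * real (card X)" by blast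
  let ?Y = "{x\<in>X. \<forall>i\<in>{1..K}. \<not> cov (h i) x}"
  obtain f where f: "f \<in> F" "real (card {x\<in>?Y. \<not> cov f x}) \<le> (1 - q) * real (card ?Y)"
    using exists_row_missing_few[of F ?Y q cov] assms by auto
  have "{x\<in>X. \<forall>i\<in>{1..Suc K}. \<not> cov ((h(Suc K := f)) i) x} = {x\<in>?Y. \<not> cov f x}"
    by (auto simp: atLeastAtMostSuc_conv)
  moreover have "(1 - q) * real (card ?Y) \<le> (1 - q) * ((1 - q) ^ K * real (card X))"
    using h(2) assms(4) by (intro mult_left_mono) auto
  ultimately have "real (card {x\<in>X. \<forall>i\<in>{1..Suc K}. \<not> cov ((h(Suc K := f)) i) x})
      \<le> (1 - q) ^ Suc K * real (card X)" using f(2) by simp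
  moreover have "\<forall>i\<in>{1..Suc K}. (h(Suc K := f)) i \<in> F"
    using h(1) f(1) by (auto simp: atLeastAtMostSuc_conv)
  ultimately show ?case by blast
qed

section \<open>Words inducing a given partition\<close>

lemma induced_partition_eqI:
  assumes "partition_on {1..t} P"
    and "\<And>i j. i \<in> {1..t} \<Longrightarrow> j \<in> {1..t} \<Longrightarrow> w i = w j \<longleftrightarrow> (\<exists>p\<in>P. i \<in> p \<and> j \<in> p)"
  shows "induced_partition t w = P"
proof -
  have "{(i, j). i \<in> {1..t} \<and> j \<in> {1..t} \<and> w i = w j} = {(i, j). \<exists>p\<in>P. i \<in> p \<and> j \<in> p}"
  proof (intro Collect_cong prod.case_cong refl)
    fix i j
    have "i \<in> {1..t} \<and> j \<in> {1..t}" if "\<exists>p\<in>P. i \<in> p \<and> j \<in> p"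
      using that partition_onD1[OF assms(1)] by blast
    then show "i \<in> {1..t} \<and> j \<in> {1..t} \<and> w i = w j \<longleftrightarrow> (\<exists>p\<in>P. i \<in> p \<and> j \<in> p)"
      using assms(2) by meson
  qed
  then show ?thesis
    using partition_on_eq_quotient[OF assms(1)] unfolding induced_partition_def by simp
qed

lemma induced_partition_cong:
  assumes "\<And>j. j \<in> {1..t} \<Longrightarrow> w j = w' j"
  shows "induced_partition t w = induced_partition t w'"
proof -
  have "{(i, j). i \<in> {1..t} \<and> j \<in> {1..t} \<and> w i = w j}
      = {(i, j). i \<in> {1..t} \<and> j \<in> {1..t} \<and> w' i = w' j}"
    using assms by (intro Collect_cong prod.case_cong refl conj_cong) simp_all
  then show ?thesis unfolding induced_partition_def by (rule arg_cong)
qed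

lemma partition_on_block_map:
  assumes "partition_on A P"
  shows "\<exists>b. (\<forall>p\<in>P. \<forall>j\<in>p. b j = p) \<and> b ` A = P"
proof -
  have ex: "\<exists>!p. p \<in> P \<and> j \<in> p" if "j \<in> A" for j
    using partition_onD1[OF assms] disjointD[OF partition_onD2[OF assms]] that by blast
  define b where "b j = (THE p. p \<in> P \<and> j \<in> p)" for j
  have 1: "b j = p" if "p \<in> P" "j \<in> p" for p j
    unfolding b_def using that ex[of j] partition_onD1[OF assms] by (intro the1_equality) auto
  moreover have "b ` A = P"
  proof
    show "b ` A \<subseteq> P" using 1 ex by blast
    show "P \<subseteq> b ` A"
    proof
      fix p assume p: "p \<in> P"
      then obtain j where "j \<in> p" using partition_onD3[OF assms] by (metis ex_in_conv)
      then show "p \<in> b ` A" using 1[OF p] p partition_onD1[OF assms] by force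
    qed
  qed
  ultimately show ?thesis by blast
qed

lemma induced_partition_const:
  assumes "partition_on {1..t} P" "card P = 1" "\<And>i. i \<in> {1..t} \<Longrightarrow> w i = a"
  shows "induced_partition t w = P"
proof (rule induced_partition_eqI[OF assms(1)])
  obtain p where "P = {p}" using assms(2) by (auto simp: card_1_singleton_iff)
  then have "P = {{1..t}}" using partition_onD1[OF assms(1)] by simp
  then show "w i = w j \<longleftrightarrow> (\<exists>p\<in>P. i \<in> p \<and> j \<in> p)" if "i \<in> {1..t}" "j \<in> {1..t}" for i j
    using that assms(3) by simp
qed

lemma induced_partition_inj:
  assumes "partition_on {1..t} P" "card P = t" "inj_on w {1..t}"
  shows "induced_partition t w = P"
proof (rule induced_partition_eqI[OF assms(1)])
  obtain b where b: "\<And>p j. p \<in> P \<Longrightarrow> j \<in> p \<Longrightarrow> b j = p" "b ` {1..t} = P"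
    using partition_on_block_map[OF assms(1)] by blast
  have inj: "inj_on b {1..t}" by (rule eq_card_imp_inj_on) (use b(2) assms(2) in auto)
  show "w i = w j \<longleftrightarrow> (\<exists>p\<in>P. i \<in> p \<and> j \<in> p)" if "i \<in> {1..t}" "j \<in> {1..t}" for i j
  proof -
    have "w i = w j \<longleftrightarrow> i = j" using assms(3) that by (rule inj_on_eq_iff)
    also have "\<dots> \<longleftrightarrow> (\<exists>p\<in>P. i \<in> p \<and> j \<in> p)"
      using inj_onD[OF inj _ that] b(1) partition_onD1[OF assms(1)] that by (metis UnionE)
    finally show ?thesis .
  qed
qed

text \<open>
  Two elements \<open>a\<close> and \<open>b\<close> of \<open>P\<close> can receive any of the \<open>s (s - 1)\<close> pairs of distinct values,
  since the remaining elements of \<open>P\<close> then still fit injectively into the unused values.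
\<close>

lemma card_injections_ge:
  fixes P :: "'a set"
  assumes "finite P" "2 \<le> card P" "card P \<le> s"
  shows "s * (s - 1) \<le> card {g \<in> P \<rightarrow>\<^sub>E {1..s}. inj_on g P}"
proof -
  obtain a b where ab: "a \<in> P" "b \<in> P" "a \<noteq> b"
    using obtain_subset_with_card_n[OF assms(2)] by (metis card_2_iff insert_subset)
  let ?G = "{g \<in> P \<rightarrow>\<^sub>E {1..s}. inj_on g P}" and ?D = "SIGMA x:{1..s}. {1..s} - {x}"
  have "?D \<subseteq> (\<lambda>g. (g a, g b)) ` ?G"
  proof
    fix z assume "z \<in> ?D"
    then obtain x y where z: "z = (x, y)" "x \<in> {1..s}" "y \<in> {1..s}" "x \<noteq> y" by blast
    have "card (P - {a, b}) \<le> card ({1..s} - {x, y})"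
      using ab z assms by (simp add: card_Diff_subset del: atLeastAtMost_iff)
    then obtain h where h: "h ` (P - {a, b}) \<subseteq> {1..s} - {x, y}" "inj_on h (P - {a, b})"
      using card_le_inj[of "P - {a, b}" "{1..s} - {x, y}"] assms(1) by auto
    define g where "g = (\<lambda>p\<in>P. if p = a then x else if p = b then y else h p)"
    have h_new: "h p \<in> {1..s}" "h p \<noteq> x" "h p \<noteq> y" if "p \<in> P" "p \<noteq> a" "p \<noteq> b" for p
      using h(1) that by blast+
    have "g \<in> P \<rightarrow>\<^sub>E {1..s}"
      using z h_new(1) by (auto simp: g_def simp del: atLeastAtMost_iff)
    moreover have "inj_on g P"
      using z(4) h_new(2,3) inj_onD[OF h(2)] by (intro inj_onI) (auto simp: g_def split: if_splits)
    ultimately show "z \<in> (\<lambda>g. (g a, g b)) ` ?G"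
      using ab z(1) by (intro image_eqI[of _ _ g]) (auto simp: g_def)
  qed
  moreover have "finite ?G"
    using assms(1) by (intro finite_subset[OF _ finite_PiE[of P "\<lambda>_. {1..s}"]]) auto
  ultimately have "card ?D \<le> card ?G" by (rule surj_card_le[rotated])
  then show ?thesis by simp
qed

text \<open>
  A row induces \<open>P\<close> on the columns \<open>c\<close> exactly when it labels the blocks of \<open>P\<close> injectively. Its
  entries outside those columns are arbitrary, so a labelling of the blocks and a filling of
  the other columns can be combined freely. As a proportion of all \<open>s ^ card V\<close> rows the bound is
  \<open>s (s - 1) / s ^ t\<close>.
\<close>

lemma card_rows_inducing_ge:
  assumes c: "inj_on c {1..t}" "c ` {1..t} \<subseteq> V" and V: "finite V"
    and P: "partition_on {1..t} P" and s: "2 \<le> card P" "card P \<le> s"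
  shows "s * (s - 1) * s ^ (card V - t)
    \<le> card {f \<in> V \<rightarrow>\<^sub>E {1..s}. induced_partition t (\<lambda>j. f (c j)) = P}"
proof -
  let ?T = "{1..t}" and ?W = "V - c ` {1..t}"
  let ?G = "{g \<in> P \<rightarrow>\<^sub>E {1..s}. inj_on g P}" and ?R = "?W \<rightarrow>\<^sub>E {1..s}"
  obtain b where b: "\<And>p j. p \<in> P \<Longrightarrow> j \<in> p \<Longrightarrow> b j = p" "b ` ?T = P"
    using partition_on_block_map[OF P] by blast
  define \<Phi> where "\<Phi> = (\<lambda>(g, r). \<lambda>x\<in>V. if x \<in> c ` ?T then g (b (inv_into ?T c x)) else r x :: nat)"
  have on_c: "\<Phi> (g, r) (c j) = g (b j)" if "j \<in> ?T" for g r j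
    using that c by (auto simp: \<Phi>_def inv_into_f_f simp del: atLeastAtMost_iff)
  have off_c: "\<Phi> (g, r) x = r x" if "x \<in> ?W" for g r x
    using that by (auto simp: \<Phi>_def)
  have finP: "finite P" using b(2) by auto
  have "inj_on \<Phi> (?G \<times> ?R)"
  proof (rule inj_onI)
    fix u v assume uv: "u \<in> ?G \<times> ?R" "v \<in> ?G \<times> ?R" "\<Phi> u = \<Phi> v"
    obtain g r g' r' where [simp]: "u = (g, r)" "v = (g', r')" by (cases u, cases v) auto
    have mem: "g \<in> P \<rightarrow>\<^sub>E {1..s}" "g' \<in> P \<rightarrow>\<^sub>E {1..s}" "r \<in> ?R" "r' \<in> ?R"
      using uv(1,2) by simp_all
    have "g = g'"
    proof (rule PiE_ext[OF mem(1,2)])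
      fix p assume "p \<in> P"
      then obtain j where "j \<in> ?T" "p = b j" using b(2) by blast
      then show "g p = g' p" using on_c uv(3) by (metis \<open>u = (g, r)\<close> \<open>v = (g', r')\<close>)
    qed
    moreover have "r = r'"
    proof (rule PiE_ext[OF mem(3,4)])
      fix x assume "x \<in> ?W"
      then show "r x = r' x" using off_c uv(3) by (metis \<open>u = (g, r)\<close> \<open>v = (g', r')\<close>)
    qed
    ultimately show "u = v" by simp
  qed
  moreover have "\<Phi> ` (?G \<times> ?R) \<subseteq> {f \<in> V \<rightarrow>\<^sub>E {1..s}. induced_partition t (\<lambda>j. f (c j)) = P}"
  proof (rule image_subsetI)
    fix u assume u: "u \<in> ?G \<times> ?R"
    then obtain g r where [simp]: "u = (g, r)" by (cases u) auto
    have g: "g \<in> P \<rightarrow>\<^sub>E {1..s}" "inj_on g P" and r: "r \<in> ?R" using u by auto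
    have "\<Phi> (g, r) \<in> V \<rightarrow>\<^sub>E {1..s}"
    proof (rule PiE_I)
      fix x assume x: "x \<in> V"
      show "\<Phi> (g, r) x \<in> {1..s}"
      proof (cases "x \<in> c ` ?T")
        case True
        then obtain j where j: "j \<in> ?T" "x = c j" by blast
        then show ?thesis using on_c[OF j(1)] b(2) PiE_mem[OF g(1)] by auto
      next
        case False
        then show ?thesis using off_c x PiE_mem[OF r] by auto
      qed
    qed (auto simp: \<Phi>_def)
    moreover have "induced_partition t (\<lambda>j. \<Phi> (g, r) (c j)) = P"
    proof (rule induced_partition_eqI[OF P])
      fix i j assume ij: "i \<in> ?T" "j \<in> ?T"
      have "\<Phi> (g, r) (c i) = \<Phi> (g, r) (c j) \<longleftrightarrow> b i = b j"
        unfolding on_c[OF ij(1)] on_c[OF ij(2)]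
        using inj_on_eq_iff[OF g(2)] b(2) ij by blast
      also have "\<dots> \<longleftrightarrow> (\<exists>p\<in>P. i \<in> p \<and> j \<in> p)"
        using b partition_onD1[OF P] ij by (metis UnionE)
      finally show "\<Phi> (g, r) (c i) = \<Phi> (g, r) (c j) \<longleftrightarrow> (\<exists>p\<in>P. i \<in> p \<and> j \<in> p)" .
    qed
    ultimately show "\<Phi> u \<in> {f \<in> V \<rightarrow>\<^sub>E {1..s}. induced_partition t (\<lambda>j. f (c j)) = P}" by simp
  qed
  moreover have "finite {f \<in> V \<rightarrow>\<^sub>E {1..s}. induced_partition t (\<lambda>j. f (c j)) = P}"
    using V by (intro finite_subset[OF _ finite_PiE[of V "\<lambda>_. {1..s}"]]) auto
  ultimately have "card (?G \<times> ?R) \<le> card {f \<in> V \<rightarrow>\<^sub>E {1..s}. induced_partition t (\<lambda>j. f (c j)) = P}"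
    using card_inj_on_le by blast
  moreover have "card ?R = s ^ (card V - t)"
    using V c by (simp add: card_PiE card_Diff_subset card_image)
  moreover have "s * (s - 1) * s ^ (card V - t) \<le> card ?G * s ^ (card V - t)"
    using card_injections_ge[OF finP s] by (rule mult_le_mono1)
  ultimately show ?thesis unfolding card_cartesian_product by (simp only: order_trans)
qed

section \<open>Deleting columns\<close>

text \<open>
  The left-hand side of the last assumption bounds the number of defects that are left after \<open>K\<close>
  greedy rows on \<open>2 n\<close> columns. At most \<open>n\<close> of them remain, so there is room to discard the
  first column of each one and to keep \<open>n\<close> columns. Two more rows then take care of the
  partitions with one block and, if \<open>s + 1 = t\<close>, with \<open>t\<close> blocks; the row with distinct entries is
  what requires \<open>n \<le> d\<close> in that case.
\<close>

lemma k0_le_if_defects_le: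
  assumes t: "2 \<le> t" and s: "2 \<le> s" "s \<le> d" "s = t \<or> s + 1 = t \<and> n \<le> d"
    and K: "real ((2 * n) ^ t * card {P. partition_on {1..t} P})
        * (1 - real (s * (s - 1)) / real s ^ t) ^ K \<le> real n"
  shows "k0 n t d \<le> K + 2"
proof -
  define V where "V = {1..2 * n}"
  define F where "F = V \<rightarrow>\<^sub>E {1..s}"
  define C where "C = {c \<in> {1..t} \<rightarrow>\<^sub>E V. inj_on c {1..t}}"
  \<comment> \<open>\<open>X\<close> is the set of possible defects.\<close>
  define X where "X = C \<times> {P. partition_on {1..t} P \<and> 2 \<le> card P \<and> card P \<le> s}"
  define q where "q = real (s * (s - 1)) / real s ^ t"
  define cov where "cov f x = (induced_partition t (\<lambda>j. f (fst x j)) = snd x)"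
    for f :: "nat \<Rightarrow> nat" and x :: "(nat \<Rightarrow> nat) \<times> nat set set"
  have V: "finite V" "card V = 2 * n" by (simp_all add: V_def)
  have F: "finite F" "F \<noteq> {}" "card F = s ^ card V"
    using V s(1) by (auto simp: F_def card_PiE PiE_eq_empty_iff intro!: finite_PiE)
  have finParts: "finite {P. partition_on {1..t} P}" by (rule finitely_many_partition_on) simp
  have C: "finite C" "card C \<le> (2 * n) ^ t"
  proof -
    have fin: "finite ({1..t} \<rightarrow>\<^sub>E V)" using V(1) by (intro finite_PiE) auto
    then show "finite C" by (rule finite_subset[rotated]) (auto simp: C_def)
    have "card C \<le> card ({1..t} \<rightarrow>\<^sub>E V)" by (rule card_mono[OF fin]) (auto simp: C_def)
    then show "card C \<le> (2 * n) ^ t" by (simp add: card_PiE V(2))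
  qed
  have finX: "finite X" unfolding X_def
    using C(1) by (intro finite_cartesian_product finite_subset[OF _ finParts]) auto
  have "card {P. partition_on {1..t} P \<and> 2 \<le> card P \<and> card P \<le> s} \<le> card {P. partition_on {1..t} P}"
    by (rule card_mono[OF finParts]) auto
  then have cardX: "card X \<le> (2 * n) ^ t * card {P. partition_on {1..t} P}"
    unfolding X_def card_cartesian_product using C(2) by (rule mult_le_mono[rotated])
  have q1: "q \<le> 1"
  proof -
    have "s * (s - 1) \<le> s ^ 2" by (simp add: power2_eq_square)
    also have "\<dots> \<le> s ^ t" using s(1) t by (intro power_increasing) auto
    finally have "real (s * (s - 1)) \<le> real s ^ t" by (metis of_nat_le_iff of_nat_power)
    then show ?thesis using s(1) by (simp add: q_def)
  qed
  have dense: "q * real (card F) \<le> real (card {f\<in>F. cov f x})" if "x \<in> X" for x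
  proof -
    obtain c P where x: "x = (c, P)" by (cases x) auto
    have c: "inj_on c {1..t}" "c ` {1..t} \<subseteq> V" and P: "partition_on {1..t} P" "2 \<le> card P" "card P \<le> s"
      using that by (auto simp: x X_def C_def)
    have "t \<le> card V" using card_inj_on_le[OF c V(1)] by simp
    then have "real s ^ card V = real s ^ t * real s ^ (card V - t)"
      by (simp add: power_add[symmetric])
    then have "q * real (card F) = real (s * (s - 1) * s ^ (card V - t))"
      using s(1) by (simp add: q_def F(3))
    also have "\<dots> \<le> real (card {f\<in>F. cov f x})"
      unfolding of_nat_le_iff cov_def x F_def fst_conv snd_conv
      by (rule card_rows_inducing_ge[OF c V(1) P])
    finally show ?thesis .
  qed
  obtain h where h: "\<forall>i\<in>{1..K}. h i \<in> F"
    "real (card {x\<in>X. \<forall>i\<in>{1..K}. \<not> cov (h i) x}) \<le> (1 - q) ^ K * real (card X)"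
    using exists_rows_missing_few[of F X q cov K] F finX q1 dense by blast
  define Bad where "Bad = {x\<in>X. \<forall>i\<in>{1..K}. \<not> cov (h i) x}"
  have "real (card Bad) \<le> (1 - q) ^ K * real (card X)" using h(2) by (simp add: Bad_def)
  also have "\<dots> \<le> (1 - q) ^ K * real ((2 * n) ^ t * card {P. partition_on {1..t} P})"
    using cardX q1 by (intro mult_left_mono) (simp_all del: of_nat_mult of_nat_power)
  also have "\<dots> \<le> real n" using K by (simp add: q_def mult.commute)
  finally have cardBad: "card Bad \<le> n" by simp
  define D where "D = (\<lambda>x. fst x 1) ` Bad"
  have "finite Bad" using finX by (simp add: Bad_def)
  then have "card D \<le> n" "finite D"
    unfolding D_def using cardBad card_image_le order_trans by blast+
  then have "n \<le> card (V - D)" using diff_card_le_card_Diff[of D V] V(2) by simp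
  then obtain S where S: "S \<subseteq> V - D" "card S = n" "finite S"
    by (rule obtain_subset_with_card_n)
  \<comment> \<open>The surviving columns may be listed in any order, because \<open>C\<close> contains all injective choices.\<close>
  obtain e where e: "bij_betw e {1..n} S"
    using ex_bij_betw_nat_finite_1[OF S(3)] S(2) by blast
  have eS: "e j \<in> S" if "j \<in> {1..n}" for j
    using e that by (rule bij_betwE[rule_format])
  define A where "A i j = (if i \<le> K then h i (e j) else if i = K + 1 \<or> s = t then 1 else j)"
    for i j :: nat
  have entries: "A i j \<in> {1..d}" if "i \<in> {1..K + 2}" "j \<in> {1..n}" for i j
  proof (cases "i \<le> K")
    case True
    then have "h i \<in> F" using h(1) that(1) by simp
    moreover have "e j \<in> V" using eS[OF that(2)] S(1) by blast
    ultimately have "h i (e j) \<in> {1..s}" unfolding F_def by (rule PiE_mem)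
    then show ?thesis using True s(2) by (simp add: A_def)
  next
    case False
    then show ?thesis using s that(2) by (auto simp: A_def)
  qed
  have covered: "\<exists>i\<in>{1..K + 2}. induced_partition t (\<lambda>j. A i (c j)) = P"
    if c: "strict_mono_on {1..t} c" "c ` {1..t} \<subseteq> {1..n}" and P: "partition_on {1..t} P" for c P
  proof -
    obtain b where b: "b ` {1..t} = P"
      using partition_on_block_map[OF P] by blast
    have injc: "inj_on c {1..t}" using c(1) by (rule strict_mono_on_imp_inj_on)
    have "card P \<le> t" using card_image_le[of "{1..t}" b] b by simp
    moreover have "P \<noteq> {}" "finite P" using b t by auto
    then have "1 \<le> card P" by (simp add: Suc_leI card_gt_0_iff)
    moreover have "s = t \<or> s + 1 = t" using s(3) by blast
    ultimately have "card P = 1 \<or> (2 \<le> card P \<and> card P \<le> s) \<or> (card P = t \<and> s \<noteq> t)"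
      by linarith
    then consider (one) "card P = 1" | (mid) "2 \<le> card P" "card P \<le> s"
      | (top) "card P = t" "s \<noteq> t" by blast
    then show ?thesis
    proof cases
      case one
      then have "induced_partition t (\<lambda>j. A (K + 1) (c j)) = P"
        by (intro induced_partition_const[OF P]) (auto simp: A_def)
      then show ?thesis by (intro bexI[of _ "K + 1"]) auto
    next
      case top
      then have "induced_partition t (\<lambda>j. A (K + 2) (c j)) = P"
        using injc by (intro induced_partition_inj[OF P]) (auto simp: A_def)
      then show ?thesis by (intro bexI[of _ "K + 2"]) auto
    next
      case mid
      define c' where "c' = (\<lambda>j\<in>{1..t}. e (c j))"
      have c'S: "c' j \<in> S" if "j \<in> {1..t}" for j
      proof -
        have "c j \<in> {1..n}" using c(2) that by blast
        then show ?thesis using eS that by (simp add: c'_def)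
      qed
      have "inj_on c' {1..t}"
      proof (rule inj_onI)
        fix i j assume ij: "i \<in> {1..t}" "j \<in> {1..t}" "c' i = c' j"
        have ci: "c i \<in> {1..n}" "c j \<in> {1..n}" using c(2) ij by blast+
        have "e (c i) = e (c j)" using ij by (simp add: c'_def)
        then have "c i = c j"
          using ci by (rule inj_onD[OF bij_betw_imp_inj_on[OF e]])
        then show "i = j" using injc ij by (meson inj_onD)
      qed
      moreover have "c' \<in> {1..t} \<rightarrow>\<^sub>E V"
        using c'S S(1) by (intro PiE_I) (auto simp: c'_def)
      ultimately have "(c', P) \<in> X" using P mid by (simp add: X_def C_def)
      \<comment> \<open>A defect at \<open>c'\<close> would have caused the column \<open>c' 1\<close> to be discarded.\<close>
      moreover have "(c', P) \<notin> Bad"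
      proof
        assume "(c', P) \<in> Bad"
        then have "c' 1 \<in> D" unfolding D_def by force
        then show False using c'S[of 1] S(1) t by auto
      qed
      ultimately obtain i where i: "i \<in> {1..K}" "induced_partition t (\<lambda>j. h i (c' j)) = P"
        unfolding Bad_def cov_def by auto
      have "induced_partition t (\<lambda>j. A i (c j)) = induced_partition t (\<lambda>j. h i (c' j))"
        using i(1) by (intro induced_partition_cong) (simp add: A_def c'_def)
      then show ?thesis using i by (intro bexI[of _ i]) auto
    qed
  qed
  have "is_partition_covering_array (K + 2) n t d A"
    unfolding is_partition_covering_array_def using entries covered by blast
  then show ?thesis unfolding k0_def by (intro Least_le) blast
qed

section \<open>Asymptotics\<close>

text \<open>
  The smallest admissible \<open>K\<close> is \<open>(t - 1) log \<gamma> n + log \<gamma> C\<close> rounded up. The constant,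
  the rounding and the \<open>m\<close> extra rows are bounded, hence vanish relative to \<open>log \<gamma> n\<close>.
\<close>

lemma asymptotic_bound_of_power_bound:
  fixes f :: "nat \<Rightarrow> nat" and \<gamma> C :: real
  assumes \<gamma>: "1 < \<gamma>" and C: "1 \<le> C" and t: "2 \<le> t"
    and f: "\<forall>\<^sub>F n in sequentially. \<forall>K. C * real n ^ (t - 1) \<le> \<gamma> ^ K \<longrightarrow> f n \<le> K + m"
  shows "\<exists>e :: nat \<Rightarrow> real. e \<in> o(\<lambda>_. 1) \<and>
    (\<forall>\<^sub>F n in sequentially. real (f n) \<le> (real t - 1) * log 2 (real n) / log 2 \<gamma> * (1 + e n))"
proof -
  define e where "e n = (log \<gamma> C + 1 + real m) / ((real t - 1) * log \<gamma> (real n))" for n :: nat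
  have "filterlim (\<lambda>n. (real t - 1) * log \<gamma> (real n)) at_top sequentially"
  proof -
    have "filterlim (\<lambda>n. ((real t - 1) / ln \<gamma>) * ln (real n)) at_top sequentially"
      using \<gamma> t by (intro filterlim_tendsto_pos_mult_at_top[OF tendsto_const]
          filterlim_compose[OF ln_at_top filterlim_real_sequentially]) auto
    then show ?thesis by (simp add: log_def)
  qed
  then have "e \<longlonglongrightarrow> 0"
    unfolding e_def by (rule tendsto_divide_0[OF tendsto_const filterlim_at_top_imp_at_infinity])
  then have "e \<in> o(\<lambda>_. 1)" by (intro smalloI_tendsto) simp_all
  moreover have "\<forall>\<^sub>F n in sequentially.
      real (f n) \<le> (real t - 1) * log 2 (real n) / log 2 \<gamma> * (1 + e n)"
    using f eventually_gt_at_top[of 1]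
  proof eventually_elim
    case (elim n)
    define y where "y = C * real n ^ (t - 1)"
    define K where "K = nat \<lceil>log \<gamma> y\<rceil>"
    have y1: "1 \<le> y" using C elim(2) by (simp add: y_def mult_ge1_I one_le_power)
    have "log \<gamma> y \<le> real K" unfolding K_def by linarith
    then have "y \<le> \<gamma> powr real K" using \<gamma> y1 by (subst (asm) log_le_iff) auto
    then have "y \<le> \<gamma> ^ K" using \<gamma> by (simp add: powr_realpow)
    then have "real (f n) \<le> real K + real m" using elim(1) unfolding y_def
      by (metis of_nat_add of_nat_mono)
    also have "real K \<le> log \<gamma> y + 1"
      using \<gamma> y1 zero_le_log_cancel_iff[of \<gamma> y] unfolding K_def by linarith
    also have "log \<gamma> y = log \<gamma> C + (real t - 1) * log \<gamma> (real n)"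
      using \<gamma> C elim(2) t by (simp add: y_def log_mult log_nat_power of_nat_diff)
    finally have "real (f n) \<le> (real t - 1) * log \<gamma> (real n) + (log \<gamma> C + 1 + real m)" by simp
    also have "\<dots> = (real t - 1) * log \<gamma> (real n) * (1 + e n)"
    proof -
      have "(real t - 1) * log \<gamma> (real n) \<noteq> 0" using \<gamma> elim(2) t by (simp add: log_def)
      moreover have "z + w = z * (1 + w / z)" if "z \<noteq> 0" for z w :: real
        using that by (simp add: distrib_left)
      ultimately show ?thesis unfolding e_def by blast
    qed
    also have "log \<gamma> (real n) = log 2 (real n) / log 2 \<gamma>"
      using \<gamma> by (simp add: log_def)
    finally show ?case by simp
  qed
  ultimately show ?thesis by blast
qed

text \<open>
  The condition on the number of defects reads \<open>(2 n) ^ t b / \<gamma> ^ K \<le> n\<close> with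
  \<open>\<gamma> = 1 / (1 - q)\<close>, and cancelling one factor \<open>n\<close> leaves the exponent \<open>t - 1\<close>.
\<close>

lemma k0_asymptotic_bound:
  assumes t: "2 \<le> t" and s: "2 \<le> s" "s = t \<or> s + 1 = t"
    and d: "\<forall>\<^sub>F n in sequentially. s \<le> d n \<and> (s = t \<or> n \<le> d n)"
  shows "\<exists>e :: nat \<Rightarrow> real. e \<in> o(\<lambda>_. 1) \<and>
    (\<forall>\<^sub>F n in sequentially. real (k0 n t (d n)) \<le>
      (real t - 1) * log 2 (real n) / log 2 (real s ^ t / (real s ^ t - real s * (real s - 1))) * (1 + e n))"
proof -
  define \<gamma> where "\<gamma> = real s ^ t / (real s ^ t - real s * (real s - 1))"
  define b where "b = card {P. partition_on {1..t} P}"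
  have b: "1 \<le> b"
  proof -
    have "partition_on {1..t} {{1..t}}" using t by (intro partition_on_space) auto
    moreover have "finite {P. partition_on {1..t} P}" by (rule finitely_many_partition_on) simp
    ultimately show ?thesis unfolding b_def by (metis One_nat_def Suc_leI card_gt_0_iff empty_iff mem_Collect_eq)
  qed
  have pos: "0 < real s * (real s - 1)" using s(1) by simp
  have "real s * (real s - 1) < real s ^ 2" using s(1) by (simp add: power2_eq_square)
  also have "\<dots> \<le> real s ^ t" using s(1) t by (intro power_increasing) auto
  finally have lt: "real s * (real s - 1) < real s ^ t" .
  have \<gamma>: "1 < \<gamma>" using pos lt by (simp add: \<gamma>_def)
  have q: "1 - real (s * (s - 1)) / real s ^ t = 1 / \<gamma>"
    using lt s(1) by (simp add: \<gamma>_def of_nat_diff diff_divide_distrib)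
  have C: "1 \<le> 2 ^ t * real b" using b by (simp add: mult_ge1_I)
  have "\<forall>\<^sub>F n in sequentially. \<forall>K. 2 ^ t * real b * real n ^ (t - 1) \<le> \<gamma> ^ K \<longrightarrow> k0 n t (d n) \<le> K + 2"
    using d
  proof eventually_elim
    case (elim n)
    show ?case
    proof (intro allI impI)
      fix K assume "2 ^ t * real b * real n ^ (t - 1) \<le> \<gamma> ^ K"
      then have "(2 ^ t * real b * real n ^ (t - 1)) * real n \<le> \<gamma> ^ K * real n"
        by (rule mult_right_mono) simp
      moreover have "(2 ^ t * real b * real n ^ (t - 1)) * real n = real ((2 * n) ^ t * b)"
        using t by (cases t) (simp_all add: power_mult_distrib)
      ultimately have le: "real ((2 * n) ^ t * b) \<le> \<gamma> ^ K * real n" by (simp only:)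
      have "0 < \<gamma> ^ K" using \<gamma> by simp
      from le have "real ((2 * n) ^ t * b) / \<gamma> ^ K \<le> real n"
        unfolding pos_divide_le_eq[OF \<open>0 < \<gamma> ^ K\<close>] by (subst mult.commute)
      then have "real ((2 * n) ^ t * b) * (1 / \<gamma>) ^ K \<le> real n"
        by (simp only: power_one_over times_divide_eq_right mult_1_right)
      then show "k0 n t (d n) \<le> K + 2" using elim s(2) unfolding b_def q[symmetric]
        by (intro k0_le_if_defects_le[OF t s(1)]) auto
    qed
  qed
  from asymptotic_bound_of_power_bound[OF \<gamma> C t this] show ?thesis unfolding \<gamma>_def .
qed

theorem theorem2p7:
  shows "(\<forall>t::nat. t \<ge> 3 \<longrightarrow>
            (\<exists>e :: nat \<Rightarrow> real. e \<in> o(\<lambda>_. 1) \<and>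
               (\<forall>\<^sub>F n in sequentially.
                  real (k0 n t n) \<le> (real t - 1) * log 2 (real n) / log 2 (alpha t) * (1 + e n)))) \<and>
         (\<forall>t::nat. t \<ge> 2 \<longrightarrow>
            (\<exists>e :: nat \<Rightarrow> real. e \<in> o(\<lambda>_. 1) \<and>
               (\<forall>\<^sub>F n in sequentially.
                  real (k0 n t t) \<le> (real t - 1) * log 2 (real n) / log 2 (beta t) * (1 + e n))))"
proof (intro conjI allI impI)
  fix t :: nat assume t: "3 \<le> t"
  have eq: "alpha t = real (t - 1) ^ t / (real (t - 1) ^ t - real (t - 1) * (real (t - 1) - 1))"
    using t by (simp add: alpha_def of_nat_diff)
  have "\<forall>\<^sub>F n in sequentially. t - 1 \<le> n \<and> (t - 1 = t \<or> n \<le> n)"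
    using eventually_ge_at_top[of "t - 1"] by simp
  then show "\<exists>e :: nat \<Rightarrow> real. e \<in> o(\<lambda>_. 1) \<and>
      (\<forall>\<^sub>F n in sequentially.
        real (k0 n t n) \<le> (real t - 1) * log 2 (real n) / log 2 (alpha t) * (1 + e n))"
    unfolding eq using t by (intro k0_asymptotic_bound[of t "t - 1" "\<lambda>n. n"]) auto
next
  fix t :: nat assume t: "2 \<le> t"
  then show "\<exists>e :: nat \<Rightarrow> real. e \<in> o(\<lambda>_. 1) \<and>
      (\<forall>\<^sub>F n in sequentially.
        real (k0 n t t) \<le> (real t - 1) * log 2 (real n) / log 2 (beta t) * (1 + e n))"
    unfolding beta_def by (intro k0_asymptotic_bound[of t t "\<lambda>_. t"]) auto
qed

end
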